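(* Let $H$ be a real Hilbert space and let $E:H\to\mathbb{R}$ be a functional with Nehari manifold $\mathcal{N}=\{u\in H\setminus\{0\}:\langle E'(u),u\rangle=0\}$. Assume: (A1) $E\in C^2(H,\mathbb{R})$, and for each $v\in H\setminus\{0\}$ the function $s\mapsto E(sv)$, $s\in(0,\infty)$, has a unique critical point $s_v>0$; (A2) $\langle E''(u)u,u\rangle<0$ for all $u\in\mathcal{N}$; (A3) there exists a constant $\sigma_0>0$ such that $\|u\|_H\ge\sigma_0$ for all $u\in\mathcal{N}$. Let $\mathcal{R}$ be a retraction on $\mathcal{N}$ and let $\{(u_n,\xi_n)\}_{n\ge0}\subset T\mathcal{N}$ be the sequence generated by the Nehari manifold optimization algorithm with nonmonotone backtracking step-sizes (described in the context). Then: (a) Assume that $\{\xi_n\}$ is a gradient-related sequence. Then every accumulation point of $\{u_n\}$ is a critical point of $E$ on $\mathcal{N}$, and therefore a nontrivial critical point of $E$ in $H$. (b) Assume that $\{\xi_n\}$ is a strongly gradient-related sequence, that $E$ satisfies the PS condition on the Nehari manifold $\mathcal{N}$, and that for some constants $\delta>0$ and $M_\delta>0$ the retraction satisfies $$\|\mathcal{R}(u,\xi)-u\|_H\le M_\delta\|\xi\|_H\quad\text{for all }(u,\xi)\in T\mathcal{N}\text{ with }E(u)\le E(u_0)\text{ and }\|\xi\|_H\le\delta.$$ Then $\{u_n\}$ possesses an accumulation point, i.e. there exists a subsequence of $\{u_n\}$ converging (in $H$) to a critical point $u_*$. (c) Under the assumptions of (b), if in addition the critical point $u_*$ (the limit of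 a subsequence of $\{u_n\}$, as in (b)) is isolated, then the whole sequence $\{u_n\}$ converges to $u_*$.
   Context: $(\cdot,\cdot)_H$ and $\|\cdot\|_H$ are the inner product and norm of $H$; $\langle\cdot,\cdot\rangle$ is the pairing between $H^*$ and $H$. Put $G(u)=\langle E'(u),u\rangle$ for $u\in H$. Under (A1)-(A3), $\mathcal{N}$ is a closed $C^1$ submanifold of $H$ with tangent space $T_u\mathcal{N}=\{\xi\in H:\langle G'(u),\xi\rangle=0\}$ and tangent bundle $T\mathcal{N}=\{(u,\xi):u\in\mathcal{N},\ \xi\in T_u\mathcal{N}\}$. Riemannian gradient: for $u\in\mathcal{N}$, $\nabla_{\mathcal{N}}E(u)$ is the unique element of $T_u\mathcal{N}$ with $(\nabla_{\mathcal{N}}E(u),\xi)_H=\langle E'(u),\xi\rangle$ for all $\xi\in T_u\mathcal{N}$. A critical point of $E$ on $\mathcal{N}$ is a point $u\in\mathcal{N}$ with $\nabla_{\mathcal{N}}E(u)=0$; a nontrivial critical point of $E$ in $H$ is $u\in H\setminus\{0\}$ with $E'(u)=0$. A critical point is isolated if some neighborhood of it contains no other critical point. Retraction: a $C^1$ map $\mathcal{R}:T\mathcal{N}\to\mathcal{N}$ ($C^1$ meaning that it has a $C^1$ extension to an open subset of $H\times H$ containing $T\mathcal{N}$) such that, writing $\mathcal{R}_u=\mathcal{R}(u,\cdot)$, for all $u\in\mathcal{N}$: (i) $\mathcal{R}_u(0)=u$; (ii) $\frac{d}{ds}\mathcal{R}_u(s\xi)|_{s=0}=\xi$ for all $\xi\in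 T_u\mathcal{N}$. Descent direction at $u\in\mathcal{N}$: a tangent vector $\xi\in T_u\mathcal{N}$ with $(\nabla_{\mathcal{N}}E(u),\xi)_H<0$. Algorithm: fix constants $\sigma\in(0,1)$, $\varrho\in[0,1)$, $\beta\in(0,1)$, $0<\alpha_{\min}<\alpha_{\max}$, and $u_0\in\mathcal{N}$. For $n=0,1,2,\dots$: choose a descent direction $\xi_n\in T_{u_n}\mathcal{N}$ at $u_n$; choose a trial step-size $\alpha_n^0\in[\alpha_{\min},\alpha_{\max}]$; let $\alpha_n=\beta^{m_n}\alpha_n^0$, where $m_n$ is the smallest nonnegative integer such that $$E(\mathcal{R}_{u_n}(\alpha_n\xi_n))\le C_n+\sigma\alpha_n(\nabla_{\mathcal{N}}E(u_n),\xi_n)_H;$$ set $u_{n+1}=\mathcal{R}_{u_n}(\alpha_n\xi_n)$. Here $C_0=E(u_0)$, $Q_0=1$, $Q_{j+1}=\varrho Q_j+1$, $C_{j+1}=\dfrac{\varrho Q_jC_j+E(u_{j+1})}{Q_{j+1}}$ for $j\ge0$. The algorithm is run without stopping, so that it generates an infinite sequence. Gradient-related: $\{\xi_n\}$ is gradient-related if for every subsequence $\{u_n\}_{n\in\mathcal{I}}$ ($\mathcal{I}\subset\mathbb{N}$) converging to a noncritical point, the corresponding subsequence $\{\xi_n\}_{n\in\mathcal{I}}$ is bounded in $H$ and $\limsup_{n\in\mathcal{I}}(\nabla_{\mathcal{N}}E(u_n),\xi_n)_H<0$. Strongly gradient-related: there exist constants $c_1,c_2>0$ such that for all $n\ge0$,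 $(\nabla_{\mathcal{N}}E(u_n),\xi_n)_H\le-c_1\|\nabla_{\mathcal{N}}E(u_n)\|_H^2$ and $\|\xi_n\|_H\le c_2\|\nabla_{\mathcal{N}}E(u_n)\|_H$. PS condition on $\mathcal{N}$: every sequence $\{w_n\}\subset\mathcal{N}$ such that $\{E(w_n)\}$ is bounded and $\|\nabla_{\mathcal{N}}E(w_n)\|_H\to0$ has a subsequence convergent in the $H$-norm. *)

theory Defs
  imports "HOL-Analysis.Analysis"
begin

section \<open>Frechet derivatives as bounded linear maps\<close>

text \<open>The Frechet derivative as an element of the normed space of bounded linear maps, so that it
  can be differentiated again. For a differentiable \<open>E :: 'a \<Rightarrow> real\<close>, \<open>fderiv E u\<close> is
  \<open>E'(u)\<close> in the dual space and \<open>fderiv (fderiv E) u\<close> is \<open>E''(u)\<close>; the duality pairing is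
  application of the bounded linear map. Unspecified where \<open>f\<close> is not differentiable.\<close>

definition fderiv ::
  "('a::real_normed_vector \<Rightarrow> 'b::real_normed_vector) \<Rightarrow> 'a \<Rightarrow> 'a \<Rightarrow>\<^sub>L 'b" where
  "fderiv f x = Blinfun (frechet_derivative f (at x))"

lemma fderiv_eqI:
  assumes "(f has_derivative blinfun_apply f') (at x)"
  shows "fderiv f x = f'"
  unfolding fderiv_def using frechet_derivative_at[OF assms] by (metis blinfun_apply_inverse)

lemma has_derivative_fderiv:
  assumes "f differentiable (at x)"
  shows "(f has_derivative blinfun_apply (fderiv f x)) (at x)"
  using assms unfolding fderiv_def frechet_derivative_works
  by (metis bounded_linear_Blinfun_apply has_derivative_bounded_linear)

definition C1_on ::
  "'a::real_normed_vector set \<Rightarrow> ('a \<Rightarrow> 'b::real_normed_vector) \<Rightarrow> bool" where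
  "C1_on U f \<longleftrightarrow> open U \<and> (\<forall>x\<in>U. f differentiable (at x)) \<and> continuous_on U (fderiv f)"

definition C2 :: "('a::real_normed_vector \<Rightarrow> 'b::real_normed_vector) \<Rightarrow> bool" where
  "C2 f \<longleftrightarrow> C1_on UNIV f \<and> C1_on UNIV (fderiv f)"


section \<open>The Nehari manifold\<close>

definition nehari :: "('a::real_inner \<Rightarrow> real) \<Rightarrow> 'a set" where
  "nehari E = {u. u \<noteq> 0 \<and> fderiv E u u = 0}"

definition nehari_G :: "('a::real_inner \<Rightarrow> real) \<Rightarrow> 'a \<Rightarrow> real" where
  "nehari_G E u = fderiv E u u"

definition nehari_tangent :: "('a::real_inner \<Rightarrow> real) \<Rightarrow> 'a \<Rightarrow> 'a set" where
  "nehari_tangent E u = {\<xi>. fderiv (nehari_G E) u \<xi> = 0}"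

definition nehari_tangent_bundle :: "('a::real_inner \<Rightarrow> real) \<Rightarrow> ('a \<times> 'a) set" where
  "nehari_tangent_bundle E = (SIGMA u:nehari E. nehari_tangent E u)"

definition nehari_grad :: "('a::real_inner \<Rightarrow> real) \<Rightarrow> 'a \<Rightarrow> 'a" where
  "nehari_grad E u = (THE g. g \<in> nehari_tangent E u \<and>
     (\<forall>\<xi>\<in>nehari_tangent E u. inner g \<xi> = fderiv E u \<xi>))"

definition nehari_critical :: "('a::real_inner \<Rightarrow> real) \<Rightarrow> 'a \<Rightarrow> bool" where
  "nehari_critical E u \<longleftrightarrow> u \<in> nehari E \<and> nehari_grad E u = 0"

definition nontrivial_critical :: "('a::real_inner \<Rightarrow> real) \<Rightarrow> 'a \<Rightarrow> bool" where
  "nontrivial_critical E u \<longleftrightarrow> u \<noteq> 0 \<and> fderiv E u = 0"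

definition isolated_nehari_critical :: "('a::real_inner \<Rightarrow> real) \<Rightarrow> 'a \<Rightarrow> bool" where
  "isolated_nehari_critical E u \<longleftrightarrow> nehari_critical E u \<and>
     (\<exists>U. open U \<and> u \<in> U \<and> (\<forall>v\<in>U. nehari_critical E v \<longrightarrow> v = u))"


section \<open>Standing assumptions\<close>

definition nehari_A1 :: "('a::real_inner \<Rightarrow> real) \<Rightarrow> bool" where
  "nehari_A1 E \<longleftrightarrow> C2 E \<and>
     (\<forall>v. v \<noteq> 0 \<longrightarrow> (\<exists>!s. s > 0 \<and> ((\<lambda>t. E (t *\<^sub>R v)) has_real_derivative 0) (at s)))"

definition nehari_A2 :: "('a::real_inner \<Rightarrow> real) \<Rightarrow> bool" where
  "nehari_A2 E \<longleftrightarrow> (\<forall>u\<in>nehari E. fderiv (fderiv E) u u u < 0)"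

definition nehari_A3 :: "('a::real_inner \<Rightarrow> real) \<Rightarrow> bool" where
  "nehari_A3 E \<longleftrightarrow> (\<exists>\<sigma>\<^sub>0>0. \<forall>u\<in>nehari E. norm u \<ge> \<sigma>\<^sub>0)"

definition nehari_PS :: "('a::real_inner \<Rightarrow> real) \<Rightarrow> bool" where
  "nehari_PS E \<longleftrightarrow> (\<forall>w :: nat \<Rightarrow> 'a.
     (\<forall>n. w n \<in> nehari E) \<and> bounded (range (\<lambda>n. E (w n))) \<and>
     (\<lambda>n. norm (nehari_grad E (w n))) \<longlonglongrightarrow> 0 \<longrightarrow>
     (\<exists>r :: nat \<Rightarrow> nat. strict_mono r \<and> convergent (w \<circ> r)))"


section \<open>Retractions\<close>

text \<open>Only the values of \<open>R\<close> on the tangent bundle matter; the \<open>C\<^sup>1\<close> extension \<open>F\<close> takes values in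
  the ambient Hilbert space.\<close>

definition nehari_retraction ::
  "('a::real_inner \<Rightarrow> real) \<Rightarrow> ('a \<times> 'a \<Rightarrow> 'a) \<Rightarrow> bool" where
  "nehari_retraction E R \<longleftrightarrow>
     R \<in> nehari_tangent_bundle E \<rightarrow> nehari E \<and>
     (\<exists>U F. nehari_tangent_bundle E \<subseteq> U \<and> C1_on U F \<and>
            (\<forall>z\<in>nehari_tangent_bundle E. F z = R z)) \<and>
     (\<forall>u\<in>nehari E. R (u, 0) = u \<and>
        (\<forall>\<xi>\<in>nehari_tangent E u. ((\<lambda>s. R (u, s *\<^sub>R \<xi>)) has_vector_derivative \<xi>) (at 0)))"

definition retraction_displacement_bound ::
  "('a::real_inner \<Rightarrow> real) \<Rightarrow> ('a \<times> 'a \<Rightarrow> 'a) \<Rightarrow> real \<Rightarrow> bool" where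
  "retraction_displacement_bound E R e \<longleftrightarrow>
     (\<exists>\<delta>>0. \<exists>M>0. \<forall>(v, \<eta>)\<in>nehari_tangent_bundle E.
        E v \<le> e \<and> norm \<eta> \<le> \<delta> \<longrightarrow> norm (R (v, \<eta>) - v) \<le> M * norm \<eta>)"


section \<open>The optimization algorithm\<close>

definition descent_direction :: "('a::real_inner \<Rightarrow> real) \<Rightarrow> 'a \<Rightarrow> 'a \<Rightarrow> bool" where
  "descent_direction E u \<xi> \<longleftrightarrow> \<xi> \<in> nehari_tangent E u \<and> inner (nehari_grad E u) \<xi> < 0"

primrec Q_seq :: "real \<Rightarrow> nat \<Rightarrow> real" where
  "Q_seq \<rho> 0 = 1"
| "Q_seq \<rho> (Suc j) = \<rho> * Q_seq \<rho> j + 1"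

primrec C_seq :: "('a \<Rightarrow> real) \<Rightarrow> real \<Rightarrow> (nat \<Rightarrow> 'a) \<Rightarrow> nat \<Rightarrow> real" where
  "C_seq E \<rho> u 0 = E (u 0)"
| "C_seq E \<rho> u (Suc j) = (\<rho> * Q_seq \<rho> j * C_seq E \<rho> u j + E (u (Suc j))) / Q_seq \<rho> (Suc j)"

text \<open>Acceptance test for the step-size \<open>\<alpha>\<close> at the point \<open>u\<close> with search direction \<open>\<xi>\<close> and
  reference value \<open>c\<close>.\<close>

definition step_accepted ::
  "('a::real_inner \<Rightarrow> real) \<Rightarrow> ('a \<times> 'a \<Rightarrow> 'a) \<Rightarrow> real \<Rightarrow> real \<Rightarrow> 'a \<Rightarrow> 'a \<Rightarrow> real \<Rightarrow> bool" where
  "step_accepted E R \<sigma> c u \<xi> \<alpha> \<longleftrightarrow>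
     E (R (u, \<alpha> *\<^sub>R \<xi>)) \<le> c + \<sigma> * \<alpha> * inner (nehari_grad E u) \<xi>"

text \<open>\<open>(u\<^sub>n, \<xi>\<^sub>n)\<close> is an infinite run of the algorithm. In step \<open>n\<close>, \<open>a\<close> is the trial step-size and
  \<open>m\<close> the smallest number of backtracking steps after which the acceptance test holds.\<close>

definition nehari_algorithm ::
  "('a::real_inner \<Rightarrow> real) \<Rightarrow> ('a \<times> 'a \<Rightarrow> 'a) \<Rightarrow> real \<Rightarrow> real \<Rightarrow> real \<Rightarrow> real \<Rightarrow> real \<Rightarrow>
   (nat \<Rightarrow> 'a) \<Rightarrow> (nat \<Rightarrow> 'a) \<Rightarrow> bool" where
  "nehari_algorithm E R \<sigma> \<rho> \<beta> \<alpha>min \<alpha>max u \<xi> \<longleftrightarrow>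
     u 0 \<in> nehari E \<and>
     (\<forall>n. descent_direction E (u n) (\<xi> n) \<and>
        (\<exists>a\<in>{\<alpha>min..\<alpha>max}. \<exists>m::nat.
           step_accepted E R \<sigma> (C_seq E \<rho> u n) (u n) (\<xi> n) (\<beta> ^ m * a) \<and>
           (\<forall>k<m. \<not> step_accepted E R \<sigma> (C_seq E \<rho> u n) (u n) (\<xi> n) (\<beta> ^ k * a)) \<and>
           u (Suc n) = R (u n, (\<beta> ^ m * a) *\<^sub>R \<xi> n)))"

definition gradient_related ::
  "('a::real_inner \<Rightarrow> real) \<Rightarrow> (nat \<Rightarrow> 'a) \<Rightarrow> (nat \<Rightarrow> 'a) \<Rightarrow> bool" where
  "gradient_related E u \<xi> \<longleftrightarrow>
     (\<forall>(r :: nat \<Rightarrow> nat) p. strict_mono r \<and> (u \<circ> r) \<longlonglongrightarrow> p \<and> p \<in> nehari E \<and> \<not> nehari_critical E p \<longrightarrow>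
        bounded (range (\<xi> \<circ> r)) \<and>
        limsup (\<lambda>k. ereal (inner (nehari_grad E (u (r k))) (\<xi> (r k)))) < 0)"

definition strongly_gradient_related ::
  "('a::real_inner \<Rightarrow> real) \<Rightarrow> (nat \<Rightarrow> 'a) \<Rightarrow> (nat \<Rightarrow> 'a) \<Rightarrow> bool" where
  "strongly_gradient_related E u \<xi> \<longleftrightarrow>
     (\<exists>c\<^sub>1>0. \<exists>c\<^sub>2>0. \<forall>n.
        inner (nehari_grad E (u n)) (\<xi> n) \<le> - c\<^sub>1 * (norm (nehari_grad E (u n)))\<^sup>2 \<and>
        norm (\<xi> n) \<le> c\<^sub>2 * norm (nehari_grad E (u n)))"

text \<open>Accumulation points of a sequence, i.e. limits of subsequences. This differs from limit points
  of the range: a value attained infinitely often counts.\<close>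

definition seq_accumulation_point :: "(nat \<Rightarrow> 'a::topological_space) \<Rightarrow> 'a \<Rightarrow> bool" where
  "seq_accumulation_point u p \<longleftrightarrow> (\<exists>r :: nat \<Rightarrow> nat. strict_mono r \<and> (u \<circ> r) \<longlonglongrightarrow> p)"

end

theory Submission
  imports Defs
begin

text \<open>
  Three ingredients carry the proof.

  Geometry. Let \<open>e\<close> and \<open>g\<close> be the Riesz representatives of \<open>E'(v)\<close> and \<open>G'(v)\<close>. By (A2),
  \<open>G'(v) v = E''(v) v v < 0\<close> on \<open>\<N>\<close>, so \<open>g \<noteq> 0\<close> and the Riemannian gradient is the projection
  \<open>e - (e \<bullet> g / g \<bullet> g) g\<close>. This formula shows that the gradient is continuous on \<open>\<N>\<close>
  (\<open>continuous_nehari_grad\<close>). Where it vanishes, \<open>E'(v) = c G'(v)\<close>, and testing with \<open>v\<close> gives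
  \<open>c = 0\<close>, so critical points on \<open>\<N>\<close> are free critical points (\<open>nehari_critical_is_critical\<close>).
  Assumption (A3) keeps limits of points of \<open>\<N>\<close> away from \<open>0\<close>, so \<open>\<N>\<close> is closed, and (A1)
  makes every point of \<open>\<N>\<close> the maximum of \<open>E\<close> along its ray, so \<open>E \<ge> E(0)\<close> on \<open>\<N>\<close>
  (\<open>E_bounded_below\<close>).

  Energy. The reference values \<open>C\<^sub>n\<close> dominate \<open>E(u\<^sub>n)\<close>, hence are bounded below, and each step
  lowers them by at least a fixed multiple of \<open>\<alpha>\<^sub>n d\<^sub>n\<close>, where \<open>d\<^sub>n > 0\<close> is minus the slope of \<open>E\<close>
  along \<open>\<xi>\<^sub>n\<close>. Therefore \<open>\<Sum> \<alpha>\<^sub>n d\<^sub>n\<close> converges (\<open>summable_decrease\<close>).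

  Line search. Along points converging in \<open>\<N>\<close> and bounded directions, the difference quotient of
  \<open>E\<close> along the retraction approaches the slope when the step-sizes tend to \<open>0\<close>
  (\<open>retraction_expansion\<close>).

  For (a), suppose a subsequence converges to a noncritical point. Then \<open>d\<^sub>n\<close> stays away from \<open>0\<close>
  along it, so \<open>\<alpha>\<^sub>n \<rightarrow> 0\<close> there by the energy estimate. Eventually \<open>\<alpha>\<^sub>n < \<alpha>\<^sub>m\<^sub>i\<^sub>n\<close>, and so the step-size
  \<open>\<alpha>\<^sub>n / \<beta>\<close> was rejected; but it tends to \<open>0\<close> as well, and since \<open>\<sigma> < 1\<close> the expansion says that such
  steps are acceptable.

  For (b), strong gradient-relatedness turns the energy estimate into the convergence of
  \<open>\<Sum> \<alpha>\<^sub>n \<parallel>\<nabla>E(u\<^sub>n)\<parallel>\<^sup>2\<close>, while a step has length at most a constant times \<open>\<alpha>\<^sub>n \<parallel>\<nabla>E(u\<^sub>n)\<parallel>\<close>.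
  As long as the gradient stays above some \<open>\<epsilon> > 0\<close>, the length is controlled by the summable
  quantity. If this held from some index on, \<open>u\<close> would converge to a noncritical point, against (a).
  So the gradient tends to \<open>0\<close> along a subsequence, and the Palais-Smale condition applies.

  For (c), the Palais-Smale condition and isolation bound the gradient from below on the iterates in
  an annulus around \<open>p\<close>. Crossing the annulus would thus consume a fixed amount of the convergent
  sum, which late iterates cannot do (\<open>converges_to_isolated\<close>).
\<close>

section \<open>Representation of bounded functionals\<close>

text \<open>The representative is the minimizer of \<open>J x = \<parallel>x\<parallel>\<^sup>2 - 2 f x\<close>. Minimizing sequences are Cauchy by
  the parallelogram law, because the linear part of \<open>J\<close> cancels in it; the condition
  \<open>J g \<le> J (g + t y)\<close> for small \<open>t\<close> then forces \<open>g \<bullet> y = f y\<close>.\<close>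
lemma riesz_representation:
  fixes f :: "'a::{real_inner, complete_space} \<Rightarrow>\<^sub>L real"
  shows "\<exists>g. \<forall>x. inner g x = f x"
proof -
  define J where "J x = (norm x)\<^sup>2 - 2 * f x" for x
  have J_lower: "- (norm f)\<^sup>2 \<le> J x" for x
  proof -
    have "f x \<le> norm f * norm x"
      using norm_blinfun[of f x] by simp
    moreover have "0 \<le> (norm x - norm f)\<^sup>2" by simp
    ultimately show ?thesis
      by (simp add: J_def power2_diff algebra_simps)
  qed
  define m where "m = Inf (range J)"
  have bdd: "bdd_below (range J)"
    using J_lower by (rule bdd_belowI2)
  have m_le: "m \<le> J x" for x
    unfolding m_def by (rule cInf_lower[OF _ bdd]) simp
  have "\<exists>x. J x < m + 1 / real (Suc n)" for n
    using cInf_lessD[of "range J" "m + 1 / real (Suc n)"] unfolding m_def by auto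
  then obtain x where x: "J (x n) < m + 1 / real (Suc n)" for n
    by metis
  have parallelogram: "(norm (y - z))\<^sup>2 \<le> 2 * J y + 2 * J z - 4 * m" for y z
  proof -
    define w where "w = (1/2) *\<^sub>R (y + z)"
    have "(norm (y - z))\<^sup>2 = 2 * J y + 2 * J z - 4 * J w"
      unfolding J_def power2_norm_eq_inner w_def
      by (simp add: blinfun.bilinear_simps inner_simps inner_commute algebra_simps)
    with m_le[of w] show ?thesis by linarith
  qed
  have "Cauchy x"
  proof (rule metric_CauchyI)
    fix e :: real
    assume "0 < e"
    then obtain N where N: "1 / real (Suc N) < e\<^sup>2 / 4"
      using nat_approx_posE[of "e\<^sup>2 / 4"] by (metis zero_less_divide_iff zero_less_numeral zero_less_power)
    have "dist (x i) (x j) < e" if "N \<le> i" "N \<le> j" for i j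
    proof -
      have "1 / real (Suc i) \<le> 1 / real (Suc N)" "1 / real (Suc j) \<le> 1 / real (Suc N)"
        using that by (simp_all add: frac_le)
      with x[of i] x[of j] N parallelogram[of "x i" "x j"] have "(norm (x i - x j))\<^sup>2 < e\<^sup>2"
        by linarith
      with \<open>0 < e\<close> show ?thesis
        by (metis dist_norm less_imp_le power2_less_imp_less)
    qed
    then show "\<exists>N. \<forall>i\<ge>N. \<forall>j\<ge>N. dist (x i) (x j) < e" by blast
  qed
  then obtain g where g: "x \<longlonglongrightarrow> g"
    using Cauchy_convergent_iff convergent_def by blast
  have "(\<lambda>n. J (x n)) \<longlonglongrightarrow> J g"
    unfolding J_def by (intro tendsto_intros g)
  moreover have "(\<lambda>n. m + 1 / real (Suc n)) \<longlonglongrightarrow> m + 0"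
    by (intro tendsto_intros LIMSEQ_inverse_real_of_nat[unfolded inverse_eq_divide])
  ultimately have "J g \<le> m + 0"
    by (rule LIMSEQ_le) (use x less_imp_le in blast)
  then have J_min: "J g \<le> J y" for y
    using m_le[of y] by linarith
  have "inner g y = f y" for y
  proof (rule ccontr)
    define c where "c = inner g y - f y"
    \<comment> \<open>The step \<open>t = - c / n\<close> would lower \<open>J\<close>. The exact minimizer of the quadratic has
      \<open>n = y \<bullet> y\<close>; adding \<open>1\<close> avoids a separate treatment of \<open>y = 0\<close>.\<close>
    define n where "n = inner y y + 1"
    assume "inner g y \<noteq> f y"
    then have c: "c \<noteq> 0" by (simp add: c_def)
    have n: "0 < n" by (simp add: n_def add_nonneg_pos)
    have expand: "J (g + t *\<^sub>R y) - J g = t\<^sup>2 * (n - 1) + 2 * t * c" for t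
      unfolding J_def power2_norm_eq_inner c_def n_def
      by (simp add: blinfun.bilinear_simps inner_simps inner_commute algebra_simps power2_eq_square)
    have "J (g + (- c / n) *\<^sub>R y) - J g = - ((c / n)\<^sup>2 * (n + 1))"
      unfolding expand using n by (simp add: field_simps power2_eq_square)
    also have "\<dots> < 0"
      using n c by simp
    finally show False
      using J_min[of "g + (- c / n) *\<^sub>R y"] by linarith
  qed
  then show ?thesis by blast
qed

definition riesz :: "('a::{real_inner, complete_space} \<Rightarrow>\<^sub>L real) \<Rightarrow> 'a" where
  "riesz f = (SOME g. \<forall>x. inner g x = f x)"

lemma inner_riesz [simp]: "inner (riesz f) x = f x"
  using someI_ex[OF riesz_representation[of f]] unfolding riesz_def by blast

lemma bounded_linear_riesz: "bounded_linear riesz"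
proof (rule bounded_linear_intro[where K = 1])
  have ext: "x = y" if "\<And>z. inner x z = inner y z" for x y :: 'a
    using that[of "x - y"] by (metis eq_iff_diff_eq_0 inner_diff_left inner_eq_zero_iff)
  show "riesz (f + g) = riesz f + riesz g" for f g :: "'a \<Rightarrow>\<^sub>L real"
    by (rule ext) (simp add: inner_simps blinfun.bilinear_simps)
  show "riesz (c *\<^sub>R f) = c *\<^sub>R riesz f" for c and f :: "'a \<Rightarrow>\<^sub>L real"
    by (rule ext) (simp add: inner_simps blinfun.bilinear_simps)
  show "norm (riesz f) \<le> norm f * 1" for f :: "'a \<Rightarrow>\<^sub>L real"
  proof (cases "riesz f = 0")
    case False
    have "(norm (riesz f))\<^sup>2 = f (riesz f)"
      by (simp add: power2_norm_eq_inner)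
    also have "\<dots> \<le> norm f * norm (riesz f)"
      using norm_blinfun[of f "riesz f"] by simp
    finally show ?thesis
      using False by (simp add: power2_eq_square)
  qed simp
qed

section \<open>Geometry of the Nehari manifold\<close>

lemma C1_on_has_derivative:
  assumes "C1_on U f" and "x \<in> U"
  shows "(f has_derivative fderiv f x) (at x)"
  using assms has_derivative_fderiv unfolding C1_on_def by blast

text \<open>Evaluation as a bounded operator, so that \<open>\<xi> \<mapsto> E''(x) \<xi> x\<close> is a composition of bounded linear
  maps and depends continuously on \<open>x\<close>.\<close>
definition blinfun_eval :: "'a::real_normed_vector \<Rightarrow> ('a \<Rightarrow>\<^sub>L 'b::real_normed_vector) \<Rightarrow>\<^sub>L 'b" where
  "blinfun_eval x = Blinfun (\<lambda>f. blinfun_apply f x)"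

lemma blinfun_eval_apply [simp]: "blinfun_eval x f = f x"
  unfolding blinfun_eval_def
  by (simp add: bounded_linear_Blinfun_apply blinfun.bounded_linear_left)

lemma bounded_linear_blinfun_eval: "bounded_linear blinfun_eval"
proof -
  have "bounded_bilinear (\<lambda>x f. blinfun_apply (f :: 'a \<Rightarrow>\<^sub>L 'b) x)"
    by (rule bounded_bilinear.flip[OF bounded_bilinear_blinfun_apply])
  then show "bounded_linear (blinfun_eval :: 'a \<Rightarrow> ('a \<Rightarrow>\<^sub>L 'b) \<Rightarrow>\<^sub>L 'b)"
    using transfer_bounded_bilinear_bounded_linearI[of _ "blinfun_eval :: 'a \<Rightarrow> ('a \<Rightarrow>\<^sub>L 'b) \<Rightarrow>\<^sub>L 'b"]
    by simp
qed

lemma has_derivative_along_ray: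
  assumes "(f has_derivative blinfun_apply f') (at (a + s *\<^sub>R b))"
  shows "((\<lambda>t. f (a + t *\<^sub>R b)) has_vector_derivative f' b) (at s)"
proof -
  have "((\<lambda>t. f (a + t *\<^sub>R b)) has_derivative (\<lambda>h. f' (h *\<^sub>R b))) (at s)"
    by (rule has_derivative_compose[where f = "\<lambda>t. a + t *\<^sub>R b", OF _ assms])
      (auto intro!: derivative_eq_intros)
  then show ?thesis
    by (simp add: has_vector_derivative_def blinfun.scaleR_right)
qed

locale nehari_setting =
  fixes E :: "'a::{real_inner, complete_space} \<Rightarrow> real"
  assumes A1: "nehari_A1 E" and A2: "nehari_A2 E" and A3: "nehari_A3 E"
begin

lemma E_deriv: "(E has_derivative fderiv E x) (at x)"
  using A1 C1_on_has_derivative unfolding nehari_A1_def C2_def by blast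

lemma E'_deriv: "(fderiv E has_derivative fderiv (fderiv E) x) (at x)"
  using A1 C1_on_has_derivative unfolding nehari_A1_def C2_def by blast

lemma continuous_E': "continuous_on S (fderiv E)"
  using A1 unfolding nehari_A1_def C2_def C1_on_def
  by (meson continuous_on_subset subset_UNIV)

lemma continuous_E'': "continuous_on S (fderiv (fderiv E))"
  using A1 unfolding nehari_A1_def C2_def C1_on_def
  by (meson continuous_on_subset subset_UNIV)

lemma nehari_G_deriv:
  "fderiv (nehari_G E) x = fderiv E x + (blinfun_eval x o\<^sub>L fderiv (fderiv E) x)"
  unfolding nehari_G_def
proof (rule fderiv_eqI)
  show "((\<lambda>x. blinfun_apply (fderiv E x) x) has_derivative
      blinfun_apply (fderiv E x + (blinfun_eval x o\<^sub>L fderiv (fderiv E) x))) (at x)"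
    by (rule has_derivative_eq_rhs[OF blinfun.FDERIV[OF E'_deriv has_derivative_ident]])
      (simp add: fun_eq_iff blinfun.bilinear_simps)
qed

lemma continuous_G': "continuous_on S (fderiv (nehari_G E))"
  unfolding nehari_G_deriv
  by (intro continuous_intros continuous_E' continuous_E''
      bounded_linear.continuous_on[OF bounded_linear_blinfun_eval])

lemma nehari_G'_transversal:
  assumes "v \<in> nehari E"
  shows "fderiv (nehari_G E) v v < 0"
  using assms A2 by (simp add: nehari_G_deriv blinfun.bilinear_simps nehari_def nehari_A2_def)

text \<open>The equation \<open>E'(v) v = 0\<close> passes to limits by continuity; the requirement \<open>v \<noteq> 0\<close> does so
  because (A3) bounds the norm from below.\<close>
lemma nehari_limit:
  assumes "\<And>n. w n \<in> nehari E" and "w \<longlonglongrightarrow> p"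
  shows "p \<in> nehari E"
proof -
  obtain s where "0 < s" and s: "\<And>v. v \<in> nehari E \<Longrightarrow> s \<le> norm v"
    using A3 unfolding nehari_A3_def by blast
  have "s \<le> norm p"
    by (rule LIMSEQ_le_const[OF tendsto_norm[OF assms(2)]]) (use s assms(1) in blast)
  with \<open>0 < s\<close> have "p \<noteq> 0" by auto
  moreover have "(\<lambda>n. fderiv E (w n) (w n)) \<longlonglongrightarrow> fderiv E p p"
    by (intro tendsto_intros assms(2) continuous_on_tendsto_compose[OF continuous_E'[of UNIV] assms(2)])
      auto
  then have "fderiv E p p = 0"
    using assms(1) by (simp add: nehari_def LIMSEQ_const_iff)
  ultimately show ?thesis by (simp add: nehari_def)
qed

text \<open>The tangent space is the orthogonal complement of \<open>g\<close>, so the gradient is the orthogonal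
  projection of \<open>e\<close> onto it. Two candidates differ by a tangent vector orthogonal to
  the tangent space, which is therefore \<open>0\<close>.\<close>
lemma nehari_grad_eq:
  assumes "v \<in> nehari E"
  defines "e \<equiv> riesz (fderiv E v)" and "g \<equiv> riesz (fderiv (nehari_G E) v)"
  shows "nehari_grad E v = e - (inner e g / inner g g) *\<^sub>R g" and "inner g g \<noteq> 0"
proof -
  have "inner g v < 0"
    using nehari_G'_transversal[OF assms(1)] by (simp add: g_def)
  then show g: "inner g g \<noteq> 0" by auto
  have tangent: "x \<in> nehari_tangent E v \<longleftrightarrow> inner g x = 0" for x
    by (simp add: nehari_tangent_def g_def)
  show "nehari_grad E v = e - (inner e g / inner g g) *\<^sub>R g"
    unfolding nehari_grad_def
  proof (rule the_equality)
    show "e - (inner e g / inner g g) *\<^sub>R g \<in> nehari_tangent E v \<and>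
        (\<forall>x\<in>nehari_tangent E v. inner (e - (inner e g / inner g g) *\<^sub>R g) x = fderiv E v x)"
      using g by (auto simp: tangent inner_simps inner_commute[of g e]) (simp add: e_def)
  next
    fix y
    assume y: "y \<in> nehari_tangent E v \<and> (\<forall>x\<in>nehari_tangent E v. inner y x = fderiv E v x)"
    define z where "z = y - (e - (inner e g / inner g g) *\<^sub>R g)"
    have z: "inner g z = 0"
      using y g by (simp add: z_def tangent inner_simps inner_commute[of g e])
    then have "inner y z = inner e z"
      using y by (simp add: tangent e_def)
    then have "inner z z = 0"
      using z by (simp add: z_def inner_diff_left)
    then show "y = e - (inner e g / inner g g) *\<^sub>R g"
      by (simp add: z_def)
  qed
qed

lemma inner_nehari_grad:
  assumes "v \<in> nehari E" and "x \<in> nehari_tangent E v"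
  shows "inner (nehari_grad E v) x = fderiv E v x"
  using assms by (simp add: nehari_grad_eq inner_diff_left nehari_tangent_def)

lemma continuous_nehari_grad: "continuous_on (nehari E) (nehari_grad E)"
proof -
  have "continuous_on (nehari E) (\<lambda>v. riesz (fderiv E v) -
      (inner (riesz (fderiv E v)) (riesz (fderiv (nehari_G E) v)) /
       inner (riesz (fderiv (nehari_G E) v)) (riesz (fderiv (nehari_G E) v)))
      *\<^sub>R riesz (fderiv (nehari_G E) v))"
    by (intro continuous_intros bounded_linear.continuous_on[OF bounded_linear_riesz]
        continuous_E' continuous_G') (use nehari_grad_eq(2) in blast)
  then show ?thesis
    by (rule continuous_on_eq) (simp add: nehari_grad_eq(1))
qed

lemma nehari_grad_tendsto:
  assumes "\<And>n. w n \<in> nehari E" and "w \<longlonglongrightarrow> p"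
  shows "(\<lambda>n. nehari_grad E (w n)) \<longlonglongrightarrow> nehari_grad E p"
  using continuous_on_tendsto_compose[OF continuous_nehari_grad assms(2)]
    nehari_limit[OF assms] assms(1) by auto

text \<open>The Lagrange multiplier \<open>c\<close> in \<open>E'(v) = c G'(v)\<close> vanishes: evaluated at \<open>v\<close>, the left side
  is \<open>0\<close> on the Nehari manifold and \<open>G'(v) v\<close> is negative.\<close>
lemma nehari_critical_is_critical:
  assumes "nehari_critical E v"
  shows "nontrivial_critical E v"
proof -
  have v: "v \<in> nehari E" and grad: "nehari_grad E v = 0"
    using assms by (auto simp: nehari_critical_def)
  define c where "c = inner (riesz (fderiv E v)) (riesz (fderiv (nehari_G E) v)) /
      inner (riesz (fderiv (nehari_G E) v)) (riesz (fderiv (nehari_G E) v))"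
  have E': "fderiv E v x = c * fderiv (nehari_G E) v x" for x
    using arg_cong[OF nehari_grad_eq(1)[OF v], of "\<lambda>y. inner y x"] grad
    by (simp add: inner_simps c_def)
  have "c * fderiv (nehari_G E) v v = 0"
    using E'[of v] v by (simp add: nehari_def)
  with nehari_G'_transversal[OF v] have "c = 0" by simp
  then have "fderiv E v = 0"
    using E' by (auto intro: blinfun_eqI)
  then show ?thesis
    using v by (simp add: nontrivial_critical_def nehari_def)
qed

text \<open>Along the ray through \<open>v\<close> the derivative \<open>\<phi>'\<close> of \<open>t \<mapsto> E (t v)\<close> vanishes at \<open>1\<close> with negative
  slope, so it is positive just to the left of \<open>1\<close>. If \<open>E v < E 0\<close>, the mean value theorem makes
  \<open>\<phi>'\<close> negative somewhere in \<open>(0, 1)\<close>, and \<open>\<phi>'\<close> would have a second positive zero, against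
  (A1).\<close>
lemma E_bounded_below:
  assumes "v \<in> nehari E"
  shows "E 0 \<le> E v"
proof (rule ccontr)
  assume "\<not> E 0 \<le> E v"
  have v: "v \<noteq> 0" "fderiv E v v = 0" "fderiv (fderiv E) v v v < 0"
    using assms A2 by (auto simp: nehari_def nehari_A2_def)
  define \<phi>' where "\<phi>' t = fderiv E (t *\<^sub>R v) v" for t
  have \<phi>: "((\<lambda>t. E (t *\<^sub>R v)) has_real_derivative \<phi>' t) (at t)" for t
    using has_derivative_along_ray[of E "fderiv E (t *\<^sub>R v)" 0 t v] E_deriv
    by (simp add: \<phi>'_def has_real_derivative_iff_has_vector_derivative)
  have unique: "t = 1" if "0 < t" "\<phi>' t = 0" for t
  proof -
    have "\<exists>!s. s > 0 \<and> ((\<lambda>t. E (t *\<^sub>R v)) has_real_derivative 0) (at s)"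
      using A1 v(1) by (auto simp: nehari_A1_def)
    moreover have "((\<lambda>t. E (t *\<^sub>R v)) has_real_derivative 0) (at t)"
      "((\<lambda>t. E (t *\<^sub>R v)) has_real_derivative 0) (at 1)"
      using \<phi>[of t] \<phi>[of 1] that(2) v(2) by (simp_all add: \<phi>'_def)
    ultimately show ?thesis using that(1) zero_less_one by blast
  qed
  have "(\<phi>' has_real_derivative fderiv (fderiv E) v v v) (at 1)"
  proof -
    have "((\<lambda>t. fderiv E (0 + t *\<^sub>R v)) has_vector_derivative fderiv (fderiv E) v v) (at 1)"
      by (rule has_derivative_along_ray) (simp add: E'_deriv)
    from bounded_linear.has_vector_derivative[OF blinfun.bounded_linear_left this]
    show ?thesis
      by (simp add: \<phi>'_def[abs_def] has_real_derivative_iff_has_vector_derivative)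
  qed
  then obtain d where "0 < d" and d: "\<And>h. 0 < h \<Longrightarrow> h < d \<Longrightarrow> \<phi>' 1 < \<phi>' (1 - h)"
    using DERIV_neg_dec_left v(3) by blast
  obtain z where z: "0 < z" "z < 1" "E v - E 0 = \<phi>' z"
    using MVT2[of 0 1 "\<lambda>t. E (t *\<^sub>R v)" \<phi>'] \<phi> by auto
  \<comment> \<open>The point \<open>1 - h\<close> lies between \<open>z\<close> and \<open>1\<close>, and close enough to \<open>1\<close> for \<open>\<phi>'\<close> to be positive.\<close>
  define h where "h = min (d / 2) ((1 - z) / 2)"
  have h: "0 < h" "h < d" "z < 1 - h"
    using \<open>0 < d\<close> z by (auto simp: h_def min_def field_simps)
  have "\<phi>' z < 0" using z(3) \<open>\<not> E 0 \<le> E v\<close> by linarith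
  moreover have "0 < \<phi>' (1 - h)" using d[OF h(1,2)] v(2) by (simp add: \<phi>'_def)
  moreover have "continuous_on {z..1 - h} \<phi>'"
    unfolding \<phi>'_def[abs_def]
    by (intro continuous_intros continuous_on_compose2[OF continuous_E'[of UNIV]]) auto
  ultimately obtain t where "z \<le> t" "t \<le> 1 - h" "\<phi>' t = 0"
    using IVT'[of \<phi>' z 0 "1 - h"] h(3) by auto
  with unique[of t] z h show False by simp
qed

section \<open>First-order expansion along a retraction\<close>

text \<open>By the mean value theorem the difference quotient is \<open>D (v\<^sub>k, s\<^sub>k \<eta>\<^sub>k) (0, \<eta>\<^sub>k)\<close> for some
  \<open>0 < s\<^sub>k < t\<^sub>k\<close>, where \<open>D\<close> is the derivative of \<open>E\<close> composed with the \<open>C\<^sup>1\<close> extension of the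
  retraction, and the slope is \<open>D (v\<^sub>k, 0) (0, \<eta>\<^sub>k)\<close>. Both operators converge to \<open>D (p, 0)\<close> in norm.
  Because this is convergence in operator norm, boundedness of the directions suffices, also in
  infinite dimension, where they may have no convergent subsequence.\<close>
lemma retraction_expansion:
  assumes R: "nehari_retraction E R"
    and v: "\<And>k. v k \<in> nehari E" "v \<longlonglongrightarrow> p"
    and \<eta>: "\<And>k. \<eta> k \<in> nehari_tangent E (v k)" "bounded (range \<eta>)"
    and t: "\<And>k. 0 < t k" "t \<longlonglongrightarrow> 0"
  shows "(\<lambda>k. (E (R (v k, t k *\<^sub>R \<eta> k)) - E (v k)) / t k - inner (nehari_grad E (v k)) (\<eta> k)) \<longlonglongrightarrow> 0"
proof -
  obtain U F where U: "nehari_tangent_bundle E \<subseteq> U" and F: "C1_on U F"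
    and FR: "\<And>z. z \<in> nehari_tangent_bundle E \<Longrightarrow> F z = R z"
    using R unfolding nehari_retraction_def by blast
  have R0: "R (w, 0) = w" if "w \<in> nehari E" for w
    using R that unfolding nehari_retraction_def by blast
  have R': "((\<lambda>s. R (w, s *\<^sub>R y)) has_vector_derivative y) (at 0)"
    if "w \<in> nehari E" "y \<in> nehari_tangent E w" for w y
    using R that unfolding nehari_retraction_def by blast
  have F': "(F has_derivative fderiv F z) (at z)" if "z \<in> U" for z
    using C1_on_has_derivative[OF F that] .
  have contF: "continuous_on U F"
    using F' by (meson has_derivative_continuous continuous_at_imp_continuous_on)
  have contF': "continuous_on U (fderiv F)"
    using F by (simp add: C1_on_def)
  define D where "D z = fderiv E (F z) o\<^sub>L fderiv F z" for z
  have contD: "continuous_on U D"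
    unfolding D_def
    by (intro continuous_intros contF' continuous_on_compose2[OF continuous_E'[of UNIV] contF]) auto
  have D: "((\<lambda>z. E (F z)) has_derivative D z) (at z)" if "z \<in> U" for z
    by (rule has_derivative_eq_rhs[OF has_derivative_compose[OF F'[OF that] E_deriv]])
      (simp add: D_def fun_eq_iff)
  have tangent_vec: "(v k, s *\<^sub>R \<eta> k) \<in> nehari_tangent_bundle E" for k s
    using v(1) \<eta>(1) by (simp add: nehari_tangent_bundle_def nehari_tangent_def blinfun.bilinear_simps)
  have curve: "((\<lambda>s. E (F (v k, s *\<^sub>R \<eta> k))) has_real_derivative D (v k, s *\<^sub>R \<eta> k) (0, \<eta> k)) (at s)" for k s
  proof -
    have "((\<lambda>z. E (F z)) has_derivative D (v k, s *\<^sub>R \<eta> k)) (at ((v k, 0) + s *\<^sub>R (0, \<eta> k)))"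
      using D tangent_vec U by (simp add: subset_iff)
    from has_derivative_along_ray[OF this] show ?thesis
      by (simp add: has_real_derivative_iff_has_vector_derivative)
  qed
  have initial_slope: "D (v k, 0) (0, \<eta> k) = inner (nehari_grad E (v k)) (\<eta> k)" for k
  proof -
    have "((\<lambda>s. F ((v k, 0) + s *\<^sub>R (0, \<eta> k))) has_vector_derivative fderiv F (v k, 0) (0, \<eta> k)) (at 0)"
      by (rule has_derivative_along_ray) (use F' tangent_vec[of k 0] U in auto)
    moreover have "((\<lambda>s. F ((v k, 0) + s *\<^sub>R (0, \<eta> k))) has_vector_derivative \<eta> k) (at 0)"
      using R'[OF v(1) \<eta>(1)] FR tangent_vec by simp
    ultimately have "fderiv F (v k, 0) (0, \<eta> k) = \<eta> k"
      by (rule vector_derivative_unique_at)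
    moreover have "F (v k, 0) = v k"
      using FR[OF tangent_vec[of k 0]] R0[OF v(1)] by simp
    ultimately show ?thesis
      by (simp add: D_def inner_nehari_grad[OF v(1) \<eta>(1)])
  qed
  have "\<exists>s. 0 < s \<and> s < t k \<and> (E (R (v k, t k *\<^sub>R \<eta> k)) - E (v k)) / t k = D (v k, s *\<^sub>R \<eta> k) (0, \<eta> k)" for k
  proof -
    obtain s where "0 < s" "s < t k"
      "E (F (v k, t k *\<^sub>R \<eta> k)) - E (F (v k, 0 *\<^sub>R \<eta> k)) = (t k - 0) * D (v k, s *\<^sub>R \<eta> k) (0, \<eta> k)"
      using MVT2[OF t(1)[of k], of "\<lambda>s. E (F (v k, s *\<^sub>R \<eta> k))" "\<lambda>s. D (v k, s *\<^sub>R \<eta> k) (0, \<eta> k)"] curve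
      by blast
    then show ?thesis
      using FR[OF tangent_vec[of k "t k"]] FR[OF tangent_vec[of k 0]] R0[OF v(1)[of k]] t(1)[of k] by auto
  qed
  then obtain s where s: "\<And>k. 0 < s k" "\<And>k. s k < t k"
    and quotient: "\<And>k. (E (R (v k, t k *\<^sub>R \<eta> k)) - E (v k)) / t k = D (v k, s k *\<^sub>R \<eta> k) (0, \<eta> k)"
    by metis
  obtain B where B: "\<And>k. norm (\<eta> k) \<le> B"
    using \<eta>(2) by (auto simp: bounded_iff)
  have p: "(p, 0) \<in> U"
    using nehari_limit[OF v] U by (auto simp: nehari_tangent_bundle_def nehari_tangent_def blinfun.bilinear_simps)
  have "s \<longlonglongrightarrow> 0"
    by (rule tendsto_sandwich[OF _ _ tendsto_const t(2)]) (use s in \<open>auto intro!: always_eventually less_imp_le\<close>)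
  then have "(\<lambda>k. s k *\<^sub>R \<eta> k) \<longlonglongrightarrow> 0"
    using B by (intro lim_null_scaleR_bounded[where B = B]) auto
  then have "(\<lambda>k. D (v k, s k *\<^sub>R \<eta> k)) \<longlonglongrightarrow> D (p, 0)"
    using tangent_vec U
    by (intro continuous_on_tendsto_compose[OF contD] tendsto_Pair v(2) p always_eventually) auto
  moreover have "(\<lambda>k. D (v k, 0)) \<longlonglongrightarrow> D (p, 0)"
    using tangent_vec[of _ 0] U
    by (intro continuous_on_tendsto_compose[OF contD] tendsto_Pair v(2) p always_eventually) auto
  ultimately have "(\<lambda>k. D (v k, s k *\<^sub>R \<eta> k) - D (v k, 0)) \<longlonglongrightarrow> D (p, 0) - D (p, 0)"
    by (rule tendsto_diff)
  then have "(\<lambda>k. norm (D (v k, s k *\<^sub>R \<eta> k) - D (v k, 0)) * B) \<longlonglongrightarrow> 0"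
    by (intro tendsto_mult_left_zero tendsto_norm_zero) simp
  then show ?thesis
  proof (rule Lim_null_comparison[rotated], intro always_eventually allI)
    fix k
    have "norm ((D (v k, s k *\<^sub>R \<eta> k) - D (v k, 0)) (0, \<eta> k)) \<le>
        norm (D (v k, s k *\<^sub>R \<eta> k) - D (v k, 0)) * norm ((0, \<eta> k) :: 'a \<times> 'a)"
      by (rule norm_blinfun)
    also have "\<dots> \<le> norm (D (v k, s k *\<^sub>R \<eta> k) - D (v k, 0)) * B"
      by (intro mult_left_mono) (simp_all add: norm_Pair B)
    finally show "norm ((E (R (v k, t k *\<^sub>R \<eta> k)) - E (v k)) / t k - inner (nehari_grad E (v k)) (\<eta> k))
        \<le> norm (D (v k, s k *\<^sub>R \<eta> k) - D (v k, 0)) * B"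
      by (simp add: quotient initial_slope blinfun.bilinear_simps)
  qed
qed

end

section \<open>Runs of the algorithm\<close>

text \<open>The consequence of backtracking that drives the convergence proof is the fourth one: an accepted step-size
  below \<open>\<alpha>min\<close> is smaller than the trial step-size, so at least one reduction took place and
  the preceding candidate \<open>\<alpha> / \<beta>\<close> failed the test.\<close>
lemma nehari_algorithm_step_sizes:
  assumes run: "nehari_algorithm E R \<sigma> \<rho> \<beta> \<alpha>min \<alpha>max u \<xi>"
    and \<beta>: "0 < \<beta>" "\<beta> < 1" and "0 < \<alpha>min"
  obtains \<alpha> where "\<And>n. 0 < \<alpha> n" "\<And>n. \<alpha> n \<le> \<alpha>max"
    "\<And>n. step_accepted E R \<sigma> (C_seq E \<rho> u n) (u n) (\<xi> n) (\<alpha> n)"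
    "\<And>n. \<alpha> n < \<alpha>min \<Longrightarrow> \<not> step_accepted E R \<sigma> (C_seq E \<rho> u n) (u n) (\<xi> n) (\<alpha> n / \<beta>)"
    "\<And>n. u (Suc n) = R (u n, \<alpha> n *\<^sub>R \<xi> n)"
proof -
  let ?acc = "\<lambda>n. step_accepted E R \<sigma> (C_seq E \<rho> u n) (u n) (\<xi> n)"
  have "\<exists>\<alpha>. 0 < \<alpha> \<and> \<alpha> \<le> \<alpha>max \<and> ?acc n \<alpha> \<and> (\<alpha> < \<alpha>min \<longrightarrow> \<not> ?acc n (\<alpha> / \<beta>)) \<and>
      u (Suc n) = R (u n, \<alpha> *\<^sub>R \<xi> n)" for n
  proof -
    obtain a m where a: "\<alpha>min \<le> a" "a \<le> \<alpha>max" and acc: "?acc n (\<beta> ^ m * a)"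
      and rej: "\<And>k. k < m \<Longrightarrow> \<not> ?acc n (\<beta> ^ k * a)"
      and u: "u (Suc n) = R (u n, (\<beta> ^ m * a) *\<^sub>R \<xi> n)"
      using run unfolding nehari_algorithm_def by fastforce
    have "\<beta> ^ m * a \<le> 1 * a"
      using \<beta> a(1) \<open>0 < \<alpha>min\<close> by (intro mult_right_mono power_le_one) auto
    then have "\<beta> ^ m * a \<le> \<alpha>max"
      using a(2) by linarith
    moreover have "\<not> ?acc n (\<beta> ^ m * a / \<beta>)" if small: "\<beta> ^ m * a < \<alpha>min"
    proof -
      obtain k where "m = Suc k"
        using small a(1) by (cases m) auto
      then show ?thesis
        using rej[of k] \<beta>(1) by simp
    qed
    ultimately show ?thesis
      using \<beta>(1) a \<open>0 < \<alpha>min\<close> acc u by (intro exI[of _ "\<beta> ^ m * a"]) auto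
  qed
  then show thesis
    using that by metis
qed

lemma Cauchy_if_summable_steps:
  fixes u :: "nat \<Rightarrow> 'a::metric_space"
  assumes a: "summable a" and steps: "\<And>n. N \<le> n \<Longrightarrow> dist (u (Suc n)) (u n) \<le> a n"
  shows "Cauchy u"
proof (rule CauchyI')
  fix e :: real
  assume "0 < e"
  define S where "S n = (\<Sum>k<n. a k)" for n
  have "Cauchy S"
    using a unfolding S_def by (simp add: summable_iff_convergent convergent_Cauchy)
  then obtain N' where N': "\<And>m n. N' \<le> m \<Longrightarrow> N' \<le> n \<Longrightarrow> dist (S m) (S n) < e"
    using \<open>0 < e\<close> unfolding Cauchy_def by blast
  have "dist (u m) (u n) < e" if "max N N' \<le> m" "m < n" for m n
  proof -
    have "dist (u m) (u n) \<le> S n - S m"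
      using less_imp_le[OF \<open>m < n\<close>]
    proof (induction n rule: dec_induct)
      case (step n)
      then show ?case
        using steps[of n] dist_triangle[of "u m" "u (Suc n)" "u n"] that(1)
        by (simp add: S_def dist_commute)
    qed simp
    also have "\<dots> < e"
      using N'[of n m] that by (simp add: dist_real_def)
    finally show ?thesis .
  qed
  then show "\<exists>M. \<forall>m\<ge>M. \<forall>n>m. dist (u m) (u n) < e" by blast
qed

lemma Q_seq_bounds:
  assumes "0 \<le> \<rho>" "\<rho> < 1"
  shows "1 \<le> Q_seq \<rho> n" and "(1 - \<rho>) * Q_seq \<rho> n \<le> 1"
proof -
  show "1 \<le> Q_seq \<rho> n"
    using assms by (induction n) simp_all
  show "(1 - \<rho>) * Q_seq \<rho> n \<le> 1"
  proof (induction n)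
    case (Suc n)
    then have "\<rho> * ((1 - \<rho>) * Q_seq \<rho> n) \<le> \<rho> * 1"
      using assms by (intro mult_left_mono)
    then show ?case by (simp add: algebra_simps)
  qed (use assms in simp)
qed

text \<open>A run of the algorithm, described by its accepted step-sizes \<open>\<alpha>\<close> in place of the trial
  step-sizes and backtracking counts.\<close>
locale backtracking_run = nehari_setting E
  for E :: "'a::{real_inner, complete_space} \<Rightarrow> real" +
  fixes R :: "'a \<times> 'a \<Rightarrow> 'a"
    and \<sigma> \<rho> \<beta> \<alpha>min \<alpha>max :: real
    and u \<xi> :: "nat \<Rightarrow> 'a"
    and \<alpha> :: "nat \<Rightarrow> real"
  assumes retraction: "nehari_retraction E R"
    and \<sigma>: "0 < \<sigma>" "\<sigma> < 1" and \<rho>: "0 \<le> \<rho>" "\<rho> < 1" and \<beta>: "0 < \<beta>" and \<alpha>min: "0 < \<alpha>min"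
    and start: "u 0 \<in> nehari E"
    and descent: "descent_direction E (u n) (\<xi> n)"
    and \<alpha>_pos: "0 < \<alpha> n" and \<alpha>_le: "\<alpha> n \<le> \<alpha>max"
    and accepted: "step_accepted E R \<sigma> (C_seq E \<rho> u n) (u n) (\<xi> n) (\<alpha> n)"
    and rejected: "\<alpha> n < \<alpha>min \<Longrightarrow> \<not> step_accepted E R \<sigma> (C_seq E \<rho> u n) (u n) (\<xi> n) (\<alpha> n / \<beta>)"
    and u_Suc: "u (Suc n) = R (u n, \<alpha> n *\<^sub>R \<xi> n)"
begin

abbreviation slope :: "nat \<Rightarrow> real" where
  "slope n \<equiv> inner (nehari_grad E (u n)) (\<xi> n)"

abbreviation C :: "nat \<Rightarrow> real" where
  "C \<equiv> C_seq E \<rho> u"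

lemma \<xi>_tangent: "\<xi> n \<in> nehari_tangent E (u n)" and slope_neg: "slope n < 0"
  using descent[of n] by (simp_all add: descent_direction_def)

lemma iterate_in_nehari: "u n \<in> nehari E"
proof (induction n)
  case (Suc n)
  have "(u n, \<alpha> n *\<^sub>R \<xi> n) \<in> nehari_tangent_bundle E"
    using Suc \<xi>_tangent[of n]
    by (simp add: nehari_tangent_bundle_def nehari_tangent_def blinfun.bilinear_simps)
  then show ?case
    using retraction unfolding u_Suc nehari_retraction_def by blast
qed (rule start)

lemma C_Suc: "C (Suc n) = C n - (C n - E (u (Suc n))) / Q_seq \<rho> (Suc n)"
proof -
  have "0 < Q_seq \<rho> (Suc n)"
    using Q_seq_bounds(1)[OF \<rho>, of "Suc n"] by linarith
  then show ?thesis by (simp add: field_simps)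
qed

lemma sufficient_decrease: "E (u (Suc n)) \<le> C n + \<sigma> * \<alpha> n * slope n"
  using accepted[of n] by (simp add: step_accepted_def u_Suc)

lemma \<alpha>_slope_neg: "\<alpha> n * slope n < 0"
  using \<alpha>_pos slope_neg by (rule mult_pos_neg)

lemma E_le_C: "E (u n) \<le> C n"
proof (cases n)
  case (Suc k)
  have "0 \<le> C k - E (u (Suc k))"
    using sufficient_decrease[of k] mult_pos_neg[OF \<sigma>(1) \<alpha>_slope_neg[of k]] by (simp add: mult.assoc)
  moreover have "(C k - E (u (Suc k))) / Q_seq \<rho> (Suc k) \<le> (C k - E (u (Suc k))) / 1"
    using calculation Q_seq_bounds(1)[OF \<rho>, of "Suc k"] by (intro divide_left_mono) auto
  ultimately show ?thesis
    unfolding Suc C_Suc by simp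
qed simp

text \<open>Nonmonotonicity costs a constant factor only: \<open>Q\<close> is bounded by the geometric series, so
  \<open>1 / Q\<^sub>n\<^sub>+\<^sub>1 \<ge> 1 - \<rho>\<close>.\<close>
lemma C_decrease: "C (Suc n) \<le> C n + (1 - \<rho>) * \<sigma> * (\<alpha> n * slope n)"
proof -
  define x where "x = - (\<sigma> * (\<alpha> n * slope n))"
  have x: "0 \<le> x" "x \<le> C n - E (u (Suc n))"
    using sufficient_decrease[of n] mult_pos_neg[OF \<sigma>(1) \<alpha>_slope_neg[of n]]
    by (simp_all add: x_def mult.assoc)
  have Q: "0 < Q_seq \<rho> (Suc n)" "(1 - \<rho>) * Q_seq \<rho> (Suc n) \<le> 1"
    using Q_seq_bounds[OF \<rho>, of "Suc n"] by simp_all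
  then have "1 - \<rho> \<le> 1 / Q_seq \<rho> (Suc n)"
    by (subst pos_le_divide_eq)
  then have "(1 - \<rho>) * x \<le> 1 / Q_seq \<rho> (Suc n) * x"
    using x(1) by (rule mult_right_mono)
  also have "\<dots> \<le> (C n - E (u (Suc n))) / Q_seq \<rho> (Suc n)"
    using x(2) Q(1) by (simp add: divide_right_mono del: Q_seq.simps)
  finally have "(1 - \<rho>) * x \<le> C n - C (Suc n)"
    unfolding C_Suc by simp
  then show ?thesis by (simp add: x_def mult.assoc del: C_seq.simps)
qed

lemma C_le_start: "C n \<le> E (u 0)"
proof (induction n)
  case (Suc n)
  have "(1 - \<rho>) * \<sigma> * (\<alpha> n * slope n) \<le> 0"
    using \<rho> \<sigma> \<alpha>_slope_neg[of n] by (intro mult_nonneg_nonpos[of "(1 - \<rho>) * \<sigma>"]) simp_all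
  with Suc C_decrease[of n] show ?case by linarith
qed simp

lemma E_le_start: "E (u n) \<le> E (u 0)"
  using E_le_C C_le_start by (rule order_trans)

lemma bounded_energy: "bounded (range (\<lambda>n. E (u (f n))))"
  by (rule bounded_subset[OF bounded_closed_interval[of "E 0" "E (u 0)"]])
    (use E_bounded_below[OF iterate_in_nehari] E_le_start in auto)

lemma summable_decrease: "summable (\<lambda>n. \<alpha> n * - slope n)"
proof (rule summableI_nonneg_bounded)
  show "0 \<le> \<alpha> n * - slope n" for n
    using \<alpha>_slope_neg[of n] by simp
  define c where "c = (1 - \<rho>) * \<sigma>"
  have c: "0 < c" using \<rho> \<sigma> by (simp add: c_def)
  show "(\<Sum>k<n. \<alpha> k * - slope k) \<le> (E (u 0) - E 0) / c" for n
  proof -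
    have "c * (\<Sum>k<n. \<alpha> k * - slope k) \<le> E (u 0) - C n"
    proof (induction n)
      case (Suc n)
      then show ?case
        using C_decrease[of n] unfolding c_def[symmetric] by (simp add: algebra_simps del: C_seq.simps)
    qed simp
    also have "\<dots> \<le> E (u 0) - E 0"
      using E_le_C[of n] E_bounded_below[OF iterate_in_nehari[of n]] by linarith
    finally show ?thesis
      using c by (simp add: pos_le_divide_eq mult.commute)
  qed
qed

text \<open>Near a noncritical accumulation point the slope is at most some \<open>- e < 0\<close>, so summability of
  \<open>\<alpha>\<^sub>n\<close> times the slope drives \<open>\<alpha>\<^sub>n\<close> to \<open>0\<close>. The rejected step-sizes \<open>t = \<alpha> / \<beta>\<close> then also tend to \<open>0\<close>.
  Rejection bounds the difference quotient below by \<open>\<sigma>\<close> times the slope, that is, at least \<open>(1 - \<sigma>) e\<close>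
  above the slope, whereas the expansion makes it approach the slope.\<close>
theorem accumulation_point_critical:
  assumes gr: "gradient_related E u \<xi>" and "seq_accumulation_point u p"
  shows "nehari_critical E p"
proof (rule ccontr)
  assume noncritical: "\<not> nehari_critical E p"
  obtain r where r: "strict_mono r" and lim: "(\<lambda>k. u (r k)) \<longlonglongrightarrow> p"
    using assms(2) by (auto simp: seq_accumulation_point_def o_def)
  have p: "p \<in> nehari E"
    using nehari_limit[OF _ lim] iterate_in_nehari by blast
  have bdd: "bounded (range (\<lambda>k. \<xi> (r k)))" and limsup: "limsup (\<lambda>k. ereal (slope (r k))) < 0"
    using gr r lim p noncritical unfolding gradient_related_def o_def by blast+
  obtain e where e: "0 < e" and steep: "eventually (\<lambda>k. slope (r k) < - e) sequentially"
  proof -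
    obtain x where x: "limsup (\<lambda>k. ereal (slope (r k))) < ereal x" "ereal x < 0"
      using ereal_dense2[OF limsup] by blast
    show thesis
      using Limsup_lessD[OF x(1)] x(2) that[of "- x"] by simp
  qed
  have "(\<lambda>k. \<alpha> (r k) * - slope (r k)) \<longlonglongrightarrow> 0"
    using LIMSEQ_subseq_LIMSEQ[OF summable_LIMSEQ_zero[OF summable_decrease] r] by (simp add: o_def)
  then have "(\<lambda>k. (\<alpha> (r k) * - slope (r k)) / e) \<longlonglongrightarrow> 0"
    by (rule tendsto_divide_zero)
  then have \<alpha>_lim: "(\<lambda>k. \<alpha> (r k)) \<longlonglongrightarrow> 0"
  proof (rule Lim_null_comparison[rotated])
    show "eventually (\<lambda>k. norm (\<alpha> (r k)) \<le> (\<alpha> (r k) * - slope (r k)) / e) sequentially"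
      using steep
    proof eventually_elim
      case (elim k)
      then have "\<alpha> (r k) * e \<le> \<alpha> (r k) * - slope (r k)"
        using \<alpha>_pos[of "r k"] by (intro mult_left_mono) auto
      then show ?case
        using \<alpha>_pos[of "r k"] by (simp only: pos_le_divide_eq[OF e] real_norm_def abs_of_pos)
    qed
  qed
  define t where "t k = \<alpha> (r k) / \<beta>" for k
  have t: "0 < t k" for k
    using \<alpha>_pos \<beta> by (simp add: t_def)
  have "t \<longlonglongrightarrow> 0"
    unfolding t_def[abs_def] by (rule tendsto_divide_zero[OF \<alpha>_lim])
  then have expansion: "(\<lambda>k. (E (R (u (r k), t k *\<^sub>R \<xi> (r k))) - E (u (r k))) / t k - slope (r k)) \<longlonglongrightarrow> 0"
    by (intro retraction_expansion[OF retraction _ lim _ bdd] iterate_in_nehari \<xi>_tangent t)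
  have "0 < (1 - \<sigma>) * e"
    using \<sigma> e by simp
  with expansion have "eventually (\<lambda>k. (E (R (u (r k), t k *\<^sub>R \<xi> (r k))) - E (u (r k))) / t k - slope (r k)
      < (1 - \<sigma>) * e) sequentially"
    by (rule order_tendstoD)
  moreover have "eventually (\<lambda>k. \<alpha> (r k) < \<alpha>min) sequentially"
    using \<alpha>_lim \<alpha>min by (rule order_tendstoD)
  ultimately have "eventually (\<lambda>k. False) sequentially"
    using steep
  proof eventually_elim
    case (elim k)
    have "C (r k) + \<sigma> * t k * slope (r k) < E (R (u (r k), t k *\<^sub>R \<xi> (r k)))"
      using rejected[OF elim(2)] by (simp add: step_accepted_def t_def not_le)
    with E_le_C[of "r k"] have "\<sigma> * slope (r k) * t k < E (R (u (r k), t k *\<^sub>R \<xi> (r k))) - E (u (r k))"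
      by (simp add: ac_simps)
    then have "\<sigma> * slope (r k) < (E (R (u (r k), t k *\<^sub>R \<xi> (r k))) - E (u (r k))) / t k"
      using t[of k] by (simp add: pos_less_divide_eq)
    with elim(1) have "- ((1 - \<sigma>) * slope (r k)) < (1 - \<sigma>) * e"
      by (simp add: algebra_simps)
    moreover have "(1 - \<sigma>) * e < (1 - \<sigma>) * - slope (r k)"
      using elim(3) \<sigma> by (intro mult_strict_left_mono) auto
    ultimately show False by simp
  qed
  then show False by simp
qed

text \<open>By continuity of the gradient, its norm along a convergent subsequence is bounded and has
  a limit, which is positive if the limit point is noncritical.\<close>
lemma strongly_gradient_related_imp_gradient_related:
  assumes "strongly_gradient_related E u \<xi>"
  shows "gradient_related E u \<xi>"
  unfolding gradient_related_def
proof (intro allI impI)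
  fix r :: "nat \<Rightarrow> nat" and p
  assume *: "strict_mono r \<and> (u \<circ> r) \<longlonglongrightarrow> p \<and> p \<in> nehari E \<and> \<not> nehari_critical E p"
  obtain c\<^sub>1 c\<^sub>2 where c: "0 < c\<^sub>1" "0 < c\<^sub>2"
    and slope_le: "\<And>n. slope n \<le> - c\<^sub>1 * (norm (nehari_grad E (u n)))\<^sup>2"
    and \<xi>_le: "\<And>n. norm (\<xi> n) \<le> c\<^sub>2 * norm (nehari_grad E (u n))"
    using assms unfolding strongly_gradient_related_def by blast
  have grad: "(\<lambda>k. nehari_grad E (u (r k))) \<longlonglongrightarrow> nehari_grad E p"
    using nehari_grad_tendsto[OF _ conjunct1[OF conjunct2[OF *]]] iterate_in_nehari by (simp add: o_def)
  then obtain B where B: "\<And>k. norm (nehari_grad E (u (r k))) \<le> B"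
    using convergent_imp_bounded[OF grad] by (auto simp: bounded_iff)
  have "norm (\<xi> (r k)) \<le> c\<^sub>2 * B" for k
    using order_trans[OF \<xi>_le mult_left_mono[OF B]] c by simp
  then have "bounded (range (\<xi> \<circ> r))"
    by (auto simp: bounded_iff)
  moreover have "limsup (\<lambda>k. ereal (slope (r k))) < 0"
  proof -
    have "limsup (\<lambda>k. ereal (slope (r k))) \<le> limsup (\<lambda>k. ereal (- c\<^sub>1 * (norm (nehari_grad E (u (r k))))\<^sup>2))"
      by (intro Limsup_mono always_eventually allI) (use slope_le in simp)
    also have "\<dots> = ereal (- c\<^sub>1 * (norm (nehari_grad E p))\<^sup>2)"
      by (intro lim_imp_Limsup tendsto_ereal tendsto_intros grad) simp
    also have "\<dots> < 0"
      using * c by (simp add: nehari_critical_def)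
    finally show ?thesis .
  qed
  ultimately show "bounded (range (\<xi> \<circ> r)) \<and> limsup (\<lambda>k. ereal (slope (r k))) < 0" ..
qed

end

section \<open>Strongly gradient-related runs\<close>

text \<open>The hypotheses of the second and third part, with their constants made explicit.\<close>
locale strongly_gradient_related_run = backtracking_run +
  fixes c\<^sub>1 c\<^sub>2 \<delta> M :: real
  assumes c\<^sub>1: "0 < c\<^sub>1" and c\<^sub>2: "0 < c\<^sub>2" and \<delta>: "0 < \<delta>" and M: "0 < M"
    and slope_le: "slope n \<le> - c\<^sub>1 * (norm (nehari_grad E (u n)))\<^sup>2"
    and \<xi>_le: "norm (\<xi> n) \<le> c\<^sub>2 * norm (nehari_grad E (u n))"
    and displacement: "(v, \<eta>) \<in> nehari_tangent_bundle E \<Longrightarrow> E v \<le> E (u 0) \<Longrightarrow> norm \<eta> \<le> \<delta> \<Longrightarrow>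
      norm (R (v, \<eta>) - v) \<le> M * norm \<eta>"
    and PS: "nehari_PS E"
begin

abbreviation grad_norm :: "nat \<Rightarrow> real" where
  "grad_norm n \<equiv> norm (nehari_grad E (u n))"

lemma gradient_related: "gradient_related E u \<xi>"
  using c\<^sub>1 c\<^sub>2 slope_le \<xi>_le
  by (intro strongly_gradient_related_imp_gradient_related) (auto simp: strongly_gradient_related_def)

lemma summable_grad: "summable (\<lambda>n. \<alpha> n * (grad_norm n)\<^sup>2)"
proof (rule summable_comparison_test'[where N = 0])
  show "summable (\<lambda>n. (\<alpha> n * - slope n) / c\<^sub>1)"
    by (rule summable_divide[OF summable_decrease])
  fix n
  have "\<alpha> n * (c\<^sub>1 * (grad_norm n)\<^sup>2) \<le> \<alpha> n * - slope n"
    using slope_le[of n] \<alpha>_pos[of n] by (intro mult_left_mono) auto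
  then have "\<alpha> n * (grad_norm n)\<^sup>2 \<le> (\<alpha> n * - slope n) / c\<^sub>1"
    by (simp only: pos_le_divide_eq[OF c\<^sub>1] ac_simps)
  then show "norm (\<alpha> n * (grad_norm n)\<^sup>2) \<le> (\<alpha> n * - slope n) / c\<^sub>1"
    using \<alpha>_pos[of n] by simp
qed

text \<open>Step-sizes are at most \<open>\<alpha>max\<close>, so \<open>(\<alpha>\<^sub>n \<parallel>\<nabla>E(u\<^sub>n)\<parallel>)\<^sup>2\<close> is at most \<open>\<alpha>max\<close> times the term of the
  convergent series.\<close>
lemma \<alpha>_grad_tendsto_0: "(\<lambda>n. \<alpha> n * grad_norm n) \<longlonglongrightarrow> 0"
proof -
  have "(\<lambda>n. \<alpha>max * (\<alpha> n * (grad_norm n)\<^sup>2)) \<longlonglongrightarrow> 0"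
    by (rule tendsto_mult_right_zero[OF summable_LIMSEQ_zero[OF summable_grad]])
  then have "(\<lambda>n. (\<alpha> n * grad_norm n)\<^sup>2) \<longlonglongrightarrow> 0"
  proof (rule Lim_null_comparison[rotated], intro always_eventually allI)
    fix n
    have "\<alpha> n * (\<alpha> n * (grad_norm n)\<^sup>2) \<le> \<alpha>max * (\<alpha> n * (grad_norm n)\<^sup>2)"
      using \<alpha>_le[of n] \<alpha>_pos[of n] by (intro mult_right_mono) auto
    then have "(\<alpha> n * grad_norm n)\<^sup>2 \<le> \<alpha>max * (\<alpha> n * (grad_norm n)\<^sup>2)"
      by (simp only: power_mult_distrib power2_eq_square[of "\<alpha> n"] mult.assoc)
    then show "norm ((\<alpha> n * grad_norm n)\<^sup>2) \<le> \<alpha>max * (\<alpha> n * (grad_norm n)\<^sup>2)"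
      by simp
  qed
  from tendsto_real_sqrt[OF this] show ?thesis
    using \<alpha>_pos by (simp add: less_imp_le)
qed

text \<open>The displacement bound concerns tangent vectors of norm at most \<open>\<delta>\<close>; the vectors
  \<open>\<alpha>\<^sub>n \<xi>\<^sub>n\<close> become that short.\<close>
lemma step_length:
  obtains N where "\<And>n. N \<le> n \<Longrightarrow> norm (u (Suc n) - u n) \<le> M * c\<^sub>2 * (\<alpha> n * grad_norm n)"
proof -
  have "(\<lambda>n. c\<^sub>2 * (\<alpha> n * grad_norm n)) \<longlonglongrightarrow> 0"
    by (rule tendsto_mult_right_zero[OF \<alpha>_grad_tendsto_0])
  then have "eventually (\<lambda>n. c\<^sub>2 * (\<alpha> n * grad_norm n) < \<delta>) sequentially"
    using \<delta> by (rule order_tendstoD)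
  then obtain N where N: "\<And>n. N \<le> n \<Longrightarrow> c\<^sub>2 * (\<alpha> n * grad_norm n) < \<delta>"
    by (auto simp: eventually_sequentially)
  show thesis
  proof (rule that)
    fix n
    assume "N \<le> n"
    have "\<alpha> n * norm (\<xi> n) \<le> \<alpha> n * (c\<^sub>2 * grad_norm n)"
      using \<xi>_le \<alpha>_pos[of n] by (intro mult_left_mono) auto
    then have le: "norm (\<alpha> n *\<^sub>R \<xi> n) \<le> c\<^sub>2 * (\<alpha> n * grad_norm n)"
      using \<alpha>_pos[of n] by (simp add: ac_simps)
    moreover have "(u n, \<alpha> n *\<^sub>R \<xi> n) \<in> nehari_tangent_bundle E"
      using iterate_in_nehari[of n] \<xi>_tangent[of n]
      by (simp add: nehari_tangent_bundle_def nehari_tangent_def blinfun.bilinear_simps)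
    ultimately have "norm (u (Suc n) - u n) \<le> M * norm (\<alpha> n *\<^sub>R \<xi> n)"
      using N[OF \<open>N \<le> n\<close>] E_le_start[of n] unfolding u_Suc by (intro displacement) auto
    also have "\<dots> \<le> M * (c\<^sub>2 * (\<alpha> n * grad_norm n))"
      using le M by (intro mult_left_mono) auto
    finally show "norm (u (Suc n) - u n) \<le> M * c\<^sub>2 * (\<alpha> n * grad_norm n)"
      by (simp add: mult.assoc)
  qed
qed

text \<open>While the gradient is at least \<open>e\<close>, one of its factors can be traded for the constant
  \<open>1 / e\<close>: path length is paid for by terms of the convergent series.\<close>
lemma step_le_decrease:
  assumes "0 < e" and "e \<le> grad_norm n"
  shows "M * c\<^sub>2 * (\<alpha> n * grad_norm n) \<le> M * c\<^sub>2 / e * (\<alpha> n * (grad_norm n)\<^sup>2)"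
proof -
  have "\<alpha> n * grad_norm n * e \<le> \<alpha> n * grad_norm n * grad_norm n"
    using assms \<alpha>_pos[of n] by (intro mult_left_mono) auto
  then have "\<alpha> n * grad_norm n \<le> (\<alpha> n * (grad_norm n)\<^sup>2) / e"
    using assms(1) by (simp add: pos_le_divide_eq power2_eq_square mult.assoc)
  then have "M * c\<^sub>2 * (\<alpha> n * grad_norm n) \<le> M * c\<^sub>2 * ((\<alpha> n * (grad_norm n)\<^sup>2) / e)"
    using M c\<^sub>2 by (intro mult_left_mono) auto
  then show ?thesis by simp
qed

text \<open>A gradient bounded away from \<open>0\<close> makes the path \<open>u\<close> of finite length, hence convergent. Its
  limit is critical by the first part, so the gradient tends to \<open>0\<close> after all.\<close>
lemma grad_not_bounded_away:
  assumes "0 < e"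
  shows "\<exists>n\<ge>N. grad_norm n < e"
proof (rule ccontr)
  assume "\<not> ?thesis"
  then have large: "e \<le> grad_norm n" if "N \<le> n" for n
    using that by (force simp: not_less)
  obtain N' where N': "\<And>n. N' \<le> n \<Longrightarrow> norm (u (Suc n) - u n) \<le> M * c\<^sub>2 * (\<alpha> n * grad_norm n)"
    using step_length by blast
  have "Cauchy u"
  proof (rule Cauchy_if_summable_steps[where N = "max N N'"])
    show "summable (\<lambda>n. M * c\<^sub>2 / e * (\<alpha> n * (grad_norm n)\<^sup>2))"
      by (rule summable_mult[OF summable_grad])
    show "dist (u (Suc n)) (u n) \<le> M * c\<^sub>2 / e * (\<alpha> n * (grad_norm n)\<^sup>2)" if "max N N' \<le> n" for n
      using N'[of n] step_le_decrease[OF assms large, of n] that by (simp add: dist_norm)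
  qed
  then obtain p where p: "u \<longlonglongrightarrow> p"
    using Cauchy_convergent by (auto simp: convergent_def)
  then have "seq_accumulation_point u p"
    unfolding seq_accumulation_point_def by (intro exI[of _ id]) (simp add: strict_mono_id)
  then have "nehari_grad E p = 0"
    using accumulation_point_critical[OF gradient_related] by (simp add: nehari_critical_def)
  then have "grad_norm \<longlonglongrightarrow> 0"
    using tendsto_norm[OF nehari_grad_tendsto[OF iterate_in_nehari p]] by simp
  then have "e \<le> 0"
    by (rule LIMSEQ_le_const) (use large in blast)
  with assms show False by simp
qed

text \<open>The index map \<open>f\<close> is arbitrary, not necessarily increasing: the same lemma serves for a
  subsequence and for an unordered choice of iterates.\<close>
lemma palais_smale_limit:
  assumes "(\<lambda>k. grad_norm (f k)) \<longlonglongrightarrow> 0"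
  obtains s p where "strict_mono (s :: nat \<Rightarrow> nat)" "(\<lambda>k. u (f (s k))) \<longlonglongrightarrow> p" "nehari_critical E p"
proof -
  have "(\<forall>k. u (f k) \<in> nehari E) \<and> bounded (range (\<lambda>k. E (u (f k)))) \<and>
      (\<lambda>k. norm (nehari_grad E (u (f k)))) \<longlonglongrightarrow> 0"
    using assms bounded_energy iterate_in_nehari by blast
  then obtain s where s: "strict_mono (s :: nat \<Rightarrow> nat)" "convergent ((\<lambda>k. u (f k)) \<circ> s)"
    using PS unfolding nehari_PS_def by meson
  then obtain p where p: "(\<lambda>k. u (f (s k))) \<longlonglongrightarrow> p"
    by (auto simp: convergent_def o_def)
  have "(\<lambda>k. grad_norm (f (s k))) \<longlonglongrightarrow> norm (nehari_grad E p)"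
    using tendsto_norm[OF nehari_grad_tendsto[OF iterate_in_nehari p]] .
  moreover have "(\<lambda>k. grad_norm (f (s k))) \<longlonglongrightarrow> 0"
    using LIMSEQ_subseq_LIMSEQ[OF assms s(1)] by (simp add: o_def)
  ultimately have "norm (nehari_grad E p) = 0"
    by (rule LIMSEQ_unique)
  moreover have "p \<in> nehari E"
    by (rule nehari_limit[OF iterate_in_nehari p])
  ultimately show thesis
    using that s(1) p by (simp add: nehari_critical_def)
qed

theorem critical_accumulation_point_exists:
  "\<exists>p. seq_accumulation_point u p \<and> nehari_critical E p"
proof -
  have "\<exists>f. \<forall>k. grad_norm (f k) < 1 / real (Suc k) \<and> f k < f (Suc k)"
  proof (rule dependent_nat_choice)
    show "\<exists>n. grad_norm n < 1 / real (Suc 0)"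
      using grad_not_bounded_away[of 1 0] by auto
    show "\<exists>m. grad_norm m < 1 / real (Suc (Suc k)) \<and> n < m" for n k
      using grad_not_bounded_away[of "1 / real (Suc (Suc k))" "Suc n"]
      by (auto simp: Suc_le_eq)
  qed
  then obtain f where f: "\<And>k. grad_norm (f k) < 1 / real (Suc k)" "strict_mono f"
    by (auto simp: strict_mono_Suc_iff)
  have "(\<lambda>k. grad_norm (f k)) \<longlonglongrightarrow> 0"
    by (rule Lim_null_comparison[OF _ LIMSEQ_inverse_real_of_nat[unfolded inverse_eq_divide]])
      (use f(1) in \<open>auto intro!: always_eventually less_imp_le\<close>)
  then obtain s p where "strict_mono (s :: nat \<Rightarrow> nat)" "(\<lambda>k. u (f (s k))) \<longlonglongrightarrow> p" "nehari_critical E p"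
    by (rule palais_smale_limit)
  then show ?thesis
    using strict_mono_o[OF f(2)] unfolding seq_accumulation_point_def o_def by blast
qed

text \<open>Otherwise iterates in the closed annulus with gradient tending to \<open>0\<close> would, by the
  Palais-Smale condition, produce a critical point in the annulus.\<close>
lemma grad_bounded_below_on_annulus:
  assumes isolated: "\<And>q. nehari_critical E q \<Longrightarrow> dist q p \<le> e \<Longrightarrow> q = p" and "0 < d"
  obtains \<gamma> where "0 < \<gamma>" "\<And>n. d \<le> dist (u n) p \<Longrightarrow> dist (u n) p \<le> e \<Longrightarrow> \<gamma> \<le> grad_norm n"
proof (rule ccontr)
  assume "\<not> thesis"
  then have "\<exists>n. d \<le> dist (u n) p \<and> dist (u n) p \<le> e \<and> grad_norm n < 1 / real (Suc k)" for k
    using that[of "1 / real (Suc k)"] by (force simp: not_le)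
  then obtain f where f: "\<And>k. d \<le> dist (u (f k)) p" "\<And>k. dist (u (f k)) p \<le> e"
    "\<And>k. grad_norm (f k) < 1 / real (Suc k)"
    by metis
  have "(\<lambda>k. grad_norm (f k)) \<longlonglongrightarrow> 0"
    by (rule Lim_null_comparison[OF _ LIMSEQ_inverse_real_of_nat[unfolded inverse_eq_divide]])
      (use f(3) in \<open>auto intro!: always_eventually less_imp_le\<close>)
  then obtain s q where lim: "(\<lambda>k. u (f (s k))) \<longlonglongrightarrow> q" and q: "nehari_critical E q"
    by (rule palais_smale_limit)
  have "(\<lambda>k. dist (u (f (s k))) p) \<longlonglongrightarrow> dist q p"
    by (intro tendsto_intros lim)
  then have "d \<le> dist q p" "dist q p \<le> e"
    using f by (auto intro: LIMSEQ_le_const LIMSEQ_le_const2)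
  with isolated[OF q] \<open>0 < d\<close> show False by auto
qed

text \<open>Each sufficiently small ball around \<open>p\<close> traps the sequence. Start at a late iterate within
  \<open>d\<close> of \<open>p\<close>. A step from the inner ball of radius \<open>d\<close> reaches at most distance \<open>2 d\<close>, because steps
  are short. In the annulus between \<open>d\<close> and \<open>4 d\<close> every further step is bounded by the increment of the
  Cauchy sequence \<open>S\<close>, whose total growth is below \<open>d\<close>. Hence the distance stays below \<open>3 d\<close>, and
  the iterates never reach the outer edge, beyond which the gradient bound is lost.\<close>
theorem converges_to_isolated:
  assumes "seq_accumulation_point u p" and isolated: "isolated_nehari_critical E p"
  shows "u \<longlonglongrightarrow> p"
proof (rule metric_LIMSEQ_I)
  fix e :: real
  assume "0 < e"
  obtain W where W: "open W" "p \<in> W" "\<And>q. q \<in> W \<Longrightarrow> nehari_critical E q \<Longrightarrow> q = p"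
    using isolated unfolding isolated_nehari_critical_def by blast
  obtain e' where e': "0 < e'" "\<And>q. dist q p < e' \<Longrightarrow> q \<in> W"
    using W(1,2) unfolding open_dist by blast
  \<comment> \<open>The factor \<open>1 / 2\<close> keeps the closed ball of radius \<open>4 d\<close> inside the open one of radius \<open>e'\<close>.\<close>
  define d where "d = min e (e' / 2) / 4"
  have d: "0 < d" "4 * d \<le> e" "4 * d < e'"
    using \<open>0 < e\<close> e'(1) by (auto simp: d_def)
  have "q = p" if "nehari_critical E q" "dist q p \<le> 4 * d" for q
    using W(3)[OF e'(2)] that d(3) by simp
  then obtain \<gamma> where "0 < \<gamma>" and
    \<gamma>: "\<And>n. d \<le> dist (u n) p \<Longrightarrow> dist (u n) p \<le> 4 * d \<Longrightarrow> \<gamma> \<le> grad_norm n"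
    using grad_bounded_below_on_annulus[OF _ d(1)] by blast
  define L where "L = M * c\<^sub>2 / \<gamma>"
  define S where "S n = (\<Sum>k<n. L * (\<alpha> k * (grad_norm k)\<^sup>2))" for n
  have S_Suc: "S (Suc n) = S n + L * (\<alpha> n * (grad_norm n)\<^sup>2)" for n
    by (simp add: S_def)
  have term_nonneg: "0 \<le> L * (\<alpha> n * (grad_norm n)\<^sup>2)" for n
    using M c\<^sub>2 \<open>0 < \<gamma>\<close> \<alpha>_pos[of n] by (simp add: L_def)
  have "convergent S"
    using summable_mult[OF summable_grad, of L] unfolding S_def summable_iff_convergent .
  then have "Cauchy S"
    by (rule convergent_Cauchy)
  then obtain N1 where N1: "\<And>m n. N1 \<le> m \<Longrightarrow> N1 \<le> n \<Longrightarrow> dist (S m) (S n) < d"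
    using d(1) unfolding Cauchy_def by blast
  obtain N2 where N2: "\<And>n. N2 \<le> n \<Longrightarrow> norm (u (Suc n) - u n) \<le> M * c\<^sub>2 * (\<alpha> n * grad_norm n)"
    using step_length by blast
  have "(\<lambda>n. M * c\<^sub>2 * (\<alpha> n * grad_norm n)) \<longlonglongrightarrow> 0"
    by (rule tendsto_mult_right_zero[OF \<alpha>_grad_tendsto_0])
  then have "eventually (\<lambda>n. M * c\<^sub>2 * (\<alpha> n * grad_norm n) < d) sequentially"
    using d(1) by (rule order_tendstoD)
  then obtain N3 where N3: "\<And>n. N3 \<le> n \<Longrightarrow> M * c\<^sub>2 * (\<alpha> n * grad_norm n) < d"
    by (auto simp: eventually_sequentially)
  define N where "N = max N1 (max N2 N3)"
  obtain n where n: "N \<le> n" "dist (u n) p < d"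
  proof -
    obtain r where r: "strict_mono r" "(\<lambda>k. u (r k)) \<longlonglongrightarrow> p"
      using assms(1) by (auto simp: seq_accumulation_point_def o_def)
    then obtain k0 where "\<And>k. k0 \<le> k \<Longrightarrow> dist (u (r k)) p < d"
      using d(1) by (meson metric_LIMSEQ_D)
    then show thesis
      using that[of "r (max k0 N)"] seq_suble[OF r(1), of "max k0 N"] by simp
  qed
  \<comment> \<open>The summand \<open>S m - S n\<close> is carried along so that the bound survives a step inside the annulus.\<close>
  have close: "dist (u m) p \<le> 2 * d + (S m - S n)" if "n \<le> m" for m
    using that
  proof (induction m rule: dec_induct)
    case base
    then show ?case using n(2) d(1) by simp
  next
    case (step m)
    have m: "N1 \<le> m" "N2 \<le> m" "N3 \<le> m" "N1 \<le> n"
      using step(1) n(1) by (auto simp: N_def)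
    have S: "S n \<le> S m"
      using step(1) by (rule lift_Suc_mono_le[rotated]) (simp add: S_Suc term_nonneg)
    have "S m - S n < d"
      using N1[OF m(1,4)] by (simp add: dist_real_def)
    have triangle: "dist (u (Suc m)) p \<le> norm (u (Suc m) - u m) + dist (u m) p"
      using dist_triangle[of "u (Suc m)" p "u m"] by (simp add: dist_norm)
    show ?case
    proof (cases "dist (u m) p < d")
      case True
      then show ?thesis
        using triangle N2[OF m(2)] N3[OF m(3)] S term_nonneg[of m] unfolding S_Suc by linarith
    next
      case False
      then have "\<gamma> \<le> grad_norm m"
        using step(3) \<open>S m - S n < d\<close> d(1) by (intro \<gamma>) auto
      then show ?thesis
        using triangle N2[OF m(2)] step_le_decrease[OF \<open>0 < \<gamma>\<close>, of m] step(3)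
        unfolding S_Suc L_def by linarith
    qed
  qed
  have "dist (u m) p < e" if "n \<le> m" for m
  proof -
    have "S m - S n < d"
      using N1[of m n] n(1) that by (simp add: N_def dist_real_def)
    then show ?thesis
      using close[OF that] d by linarith
  qed
  then show "\<exists>n. \<forall>m\<ge>n. dist (u m) p < e" by blast
qed

end

theorem theorem4p3:
  fixes E :: "'a::{real_inner, complete_space} \<Rightarrow> real"
    and R :: "'a \<times> 'a \<Rightarrow> 'a"
    and \<sigma> \<rho> \<beta> \<alpha>min \<alpha>max :: real
    and u \<xi> :: "nat \<Rightarrow> 'a"
  assumes "nehari_A1 E" and "nehari_A2 E" and "nehari_A3 E"
    and "nehari_retraction E R"
    and "0 < \<sigma>" and "\<sigma> < 1" and "0 \<le> \<rho>" and "\<rho> < 1" and "0 < \<beta>" and "\<beta> < 1"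
    and "0 < \<alpha>min" and "\<alpha>min < \<alpha>max"
    and "nehari_algorithm E R \<sigma> \<rho> \<beta> \<alpha>min \<alpha>max u \<xi>"
  shows
    "(gradient_related E u \<xi> \<longrightarrow>
        (\<forall>p. seq_accumulation_point u p \<longrightarrow> nehari_critical E p \<and> nontrivial_critical E p)) \<and>
     (strongly_gradient_related E u \<xi> \<and> nehari_PS E \<and>
        retraction_displacement_bound E R (E (u 0)) \<longrightarrow>
        (\<exists>p. seq_accumulation_point u p \<and> nehari_critical E p)) \<and>
     (strongly_gradient_related E u \<xi> \<and> nehari_PS E \<and>
        retraction_displacement_bound E R (E (u 0)) \<longrightarrow>
        (\<forall>p. seq_accumulation_point u p \<and> isolated_nehari_critical E p \<longrightarrow> u \<longlonglongrightarrow> p))"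
proof -
  obtain \<alpha> where \<alpha>: "\<And>n. 0 < \<alpha> n" "\<And>n. \<alpha> n \<le> \<alpha>max"
    "\<And>n. step_accepted E R \<sigma> (C_seq E \<rho> u n) (u n) (\<xi> n) (\<alpha> n)"
    "\<And>n. \<alpha> n < \<alpha>min \<Longrightarrow> \<not> step_accepted E R \<sigma> (C_seq E \<rho> u n) (u n) (\<xi> n) (\<alpha> n / \<beta>)"
    "\<And>n. u (Suc n) = R (u n, \<alpha> n *\<^sub>R \<xi> n)"
    using nehari_algorithm_step_sizes[OF assms(13) assms(9,10,11)] by blast
  interpret backtracking_run E R \<sigma> \<rho> \<beta> \<alpha>min \<alpha>max u \<xi> \<alpha>
    by unfold_locales (use assms \<alpha> in \<open>auto simp: nehari_algorithm_def\<close>)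
  have run: "\<exists>c\<^sub>1 c\<^sub>2 \<delta> M. strongly_gradient_related_run E R \<sigma> \<rho> \<beta> \<alpha>min \<alpha>max u \<xi> \<alpha> c\<^sub>1 c\<^sub>2 \<delta> M"
    if hyps: "strongly_gradient_related E u \<xi> \<and> nehari_PS E \<and> retraction_displacement_bound E R (E (u 0))"
  proof -
    obtain c\<^sub>1 c\<^sub>2 where c: "0 < c\<^sub>1" "0 < c\<^sub>2"
      "\<And>n. slope n \<le> - c\<^sub>1 * (norm (nehari_grad E (u n)))\<^sup>2"
      "\<And>n. norm (\<xi> n) \<le> c\<^sub>2 * norm (nehari_grad E (u n))"
      using hyps unfolding strongly_gradient_related_def by blast
    obtain \<delta> M where M: "0 < \<delta>" "0 < M"
      "\<And>v \<eta>. (v, \<eta>) \<in> nehari_tangent_bundle E \<Longrightarrow> E v \<le> E (u 0) \<Longrightarrow> norm \<eta> \<le> \<delta> \<Longrightarrow>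
        norm (R (v, \<eta>) - v) \<le> M * norm \<eta>"
      using hyps unfolding retraction_displacement_bound_def by blast
    have "strongly_gradient_related_run E R \<sigma> \<rho> \<beta> \<alpha>min \<alpha>max u \<xi> \<alpha> c\<^sub>1 c\<^sub>2 \<delta> M"
      by unfold_locales (use c M hyps in auto)
    then show ?thesis by blast
  qed
  show ?thesis
  proof (intro conjI impI allI)
    fix p
    assume "gradient_related E u \<xi>" "seq_accumulation_point u p"
    then show "nehari_critical E p"
      by (rule accumulation_point_critical)
    then show "nontrivial_critical E p"
      by (rule nehari_critical_is_critical)
  next
    assume "strongly_gradient_related E u \<xi> \<and> nehari_PS E \<and> retraction_displacement_bound E R (E (u 0))"
    with run show "\<exists>p. seq_accumulation_point u p \<and> nehari_critical E p"
      using strongly_gradient_related_run.critical_accumulation_point_exists by blast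
  next
    fix p
    assume "strongly_gradient_related E u \<xi> \<and> nehari_PS E \<and> retraction_displacement_bound E R (E (u 0))"
      and p: "seq_accumulation_point u p \<and> isolated_nehari_critical E p"
    with run obtain c\<^sub>1 c\<^sub>2 \<delta> M where
      "strongly_gradient_related_run E R \<sigma> \<rho> \<beta> \<alpha>min \<alpha>max u \<xi> \<alpha> c\<^sub>1 c\<^sub>2 \<delta> M"
      by blast
    with p show "u \<longlonglongrightarrow> p"
      by (blast intro: strongly_gradient_related_run.converges_to_isolated)
  qed
qed

end
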